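(* Let $(c_h^{n},\mu_h^{n},r_h^{n})$ be produced by the SAV-BDF1 scheme: $c_h^0\in V_h$ and $r_h^0\in\mathbb{R}$ are given initial data, and for every $n\ge 0$ the triple $(c_h^{n+1},\mu_h^{n+1},r_h^{n+1})\in V_h\times V_h\times\mathbb{R}$ satisfies, for all $(v_h,q_h)\in V_h\times V_h$, $$\rho(c_h^{n+1}-c_h^{n},v_h)=-\Delta t\,(M(c_h^n)\nabla_{\Gamma_h}\mu_h^{n+1},\nabla_{\Gamma_h}v_h)-h\Delta t\int_{\Omega_h^\Gamma}(\mathbf{n}_h\cdot\nabla\mu_h^{n+1})(\mathbf{n}_h\cdot\nabla v_h)\,dx,$$ $$(\mu_h^{n+1},q_h)=\frac{r_h^{n+1}}{\sqrt{E_1(c_h^n)}}(f_0'(c_h^n),q_h)+\epsilon^2(\nabla_{\Gamma_h}c_h^{n+1},\nabla_{\Gamma_h}q_h)+h^{-1}\epsilon^2\int_{\Omega_h^\Gamma}(\mathbf{n}_h\cdot\nabla c_h^{n+1})(\mathbf{n}_h\cdot\nabla q_h)\,dx,$$ $$r_h^{n+1}-r_h^n=\frac{1}{2\sqrt{E_1(c_h^n)}}(f_0'(c_h^n),c_h^{n+1}-c_h^n).$$ Define the modified discrete energy, for $n\ge 0$, $$\tilde E_h^{n}=\frac{\epsilon^2}{2}\|\nabla_{\Gamma_h}c_h^{n}\|^2+|r_h^{n}|^2+\frac{h^{-1}\epsilon^2}{2}\|\mathbf{n}_h\cdot\nabla c_h^{n}\|^2_{L^2(\Omega_h^\Gamma)}.$$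 Then the scheme admits the following energy balance: $$\left(\tilde E_h^{n+1}-\tilde E_h^{n}\right)+\frac{\epsilon^2}{2}\|\nabla_{\Gamma_h}c_h^{n+1}-\nabla_{\Gamma_h}c_h^{n}\|^2+|r_h^{n+1}-r_h^n|^2+\frac{h^{-1}\epsilon^2}{2}\|\mathbf{n}_h\cdot\nabla(c_h^{n+1}-c_h^n)\|^2_{L^2(\Omega_h^\Gamma)}$$ $$=-\frac{\Delta t}{\rho}(M(c_h^n)\nabla_{\Gamma_h}\mu_h^{n+1},\nabla_{\Gamma_h}\mu_h^{n+1})-\frac{h\Delta t}{\rho}\|\mathbf{n}_h\cdot\nabla\mu_h^{n+1}\|^2_{L^2(\Omega_h^\Gamma)}.$$ In particular, this implies that the scheme is energy stable in the sense that $\tilde E_h^{n+1}\le\tilde E_h^{n}$ for all $n=0,1,2,\dots$.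
   Context: Let $\Gamma\subset\mathbb{R}^3$ be a closed, sufficiently smooth surface contained in a bulk domain $\Omega\subset\mathbb{R}^3$ and given as $\Gamma=\{\mathbf{x}\in\Omega:\phi(\mathbf{x})=0\}$, where $\phi$ is sufficiently smooth (at least Lipschitz continuous) with $|\nabla\phi|$ bounded below by a positive constant in a 3D neighborhood of $\Gamma$. Let $\mathcal{T}_h$ be a triangulation of $\Omega$ into shape-regular tetrahedra, with mesh size $h>0$. $\mathcal{T}_h^\Gamma$ is the set of tetrahedra having nonempty intersection with $\Gamma$, and $\Omega_h^\Gamma$ is the domain formed by the tetrahedra in $\mathcal{T}_h^\Gamma$. The finite element space is $V_h=\{v\in C(\Omega_h^\Gamma): v\in P_1(T)\ \text{for any } T\in\mathcal{T}_h^\Gamma\}$. Let $\phi_h$ be the $P_1$ Lagrange interpolant of $\phi$ on the mesh and let the discrete surface $\Gamma_h$ be the zero level set of $\phi_h$. Set $\mathbf{n}_h=\nabla\phi_h/|\nabla\phi_h|$, $\mathbf{P}_h=\mathbf{I}-\mathbf{n}_h\mathbf{n}_h^T$, and for $v\in V_h$ the surface gradient $\nabla_{\Gamma_h}v=\mathbf{P}_h\nabla v$ on $\Gamma_h$. $(\cdot,\cdot)$ and $\|\cdot\|$ denote the $L^2(\Gamma_h)$ inner product and norm. The constants are: density $\rho>0$, interface thickness $\epsilon>0$, time step $\Delta t>0$. The free energy per unit surface is $f_0(c)=\frac14c^2(1-c)^2$, the mobility is the degenerate mobility $M(c)=c(1-c)$, and $E_1(c)=\int_\Gamma f_0(c)\,ds$.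 It is assumed throughout that $E_1(c)>0$. The initial value of the scalar auxiliary variable is $r_h^0=\sqrt{E_1(c_0)}$ with $c_0$ the initial concentration, $c_h^0\in V_h$ being its discrete counterpart.
   Formalization: The energy balance is proved as stated; the inequality Ẽ^{n+1} ≤ Ẽ^n is proved for each n with M(c_h^n) ≥ 0 on Γ_h, since c_h^n may leave [0,1], where M(c)=c(1-c) is negative and the energy can increase. *)

theory Defs
  imports "HOL-Analysis.Analysis"
begin

section \<open>Surface measure\<close>

text \<open>
  Surface integrals are taken with respect to the two-dimensional Hausdorff measure on Borel sets,
  which is defined on \<open>\<Gamma>\<close> and on the piecewise planar \<open>\<Gamma>\<^sub>h\<close> alike.  The factor \<open>\<pi>/4\<close> (the area of a
  disc of diameter one) makes it agree with area on planes.  Boundedness is demanded explicitly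
  because \<^const>\<open>diameter\<close> is meaningless on unbounded sets.  The outer measure is a metric one,
  so it is countably additive on the Borel sets, as \<^const>\<open>measure_of\<close> requires.
\<close>

definition hausdorff2_delta :: "real \<Rightarrow> (real^3) set \<Rightarrow> ennreal" where
  "hausdorff2_delta \<delta> A =
     (INF U \<in> {U :: nat \<Rightarrow> (real^3) set.
                A \<subseteq> (\<Union>i. U i) \<and> (\<forall>i. bounded (U i) \<and> diameter (U i) \<le> \<delta>)}.
        \<Sum>i. ennreal (pi / 4 * (diameter (U i))\<^sup>2))"

definition hausdorff2_outer :: "(real^3) set \<Rightarrow> ennreal" where
  "hausdorff2_outer A = (SUP \<delta> \<in> {0<..}. hausdorff2_delta \<delta> A)"

definition surface_measure :: "(real^3) measure" where
  "surface_measure = measure_of UNIV (sets borel) hausdorff2_outer"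

definition l2_inner :: "'a measure \<Rightarrow> 'a set \<Rightarrow> ('a \<Rightarrow> 'b::real_inner) \<Rightarrow> ('a \<Rightarrow> 'b) \<Rightarrow> real" where
  "l2_inner M A u v = (LINT x:A|M. u x \<bullet> v x)"

definition l2_norm :: "'a measure \<Rightarrow> 'a set \<Rightarrow> ('a \<Rightarrow> 'b::real_normed_vector) \<Rightarrow> real" where
  "l2_norm M A u = sqrt (LINT x:A|M. (norm (u x))\<^sup>2)"


section \<open>The surface and the mesh\<close>

text \<open>
  ``Sufficiently smooth'' is read as: \<open>\<phi>\<close> is Lipschitz on the closed bulk domain and \<open>C\<^sup>1\<close> near \<open>\<Gamma>\<close>.
  Together with the lower bound on the gradient and compactness, this makes \<open>\<Gamma>\<close> a closed \<open>C\<^sup>1\<close>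
  surface by the implicit function theorem.
\<close>

definition level_set_surface :: "(real^3) set \<Rightarrow> (real^3 \<Rightarrow> real) \<Rightarrow> (real^3) set \<Rightarrow> bool" where
  "level_set_surface \<Omega> \<phi> \<Gamma> \<longleftrightarrow>
     \<Gamma> = {x \<in> \<Omega>. \<phi> x = 0} \<and> \<Gamma> \<noteq> {} \<and> compact \<Gamma> \<and>
     (\<exists>L. L-lipschitz_on (closure \<Omega>) \<phi>) \<and>
     (\<exists>U G m. open U \<and> \<Gamma> \<subseteq> U \<and> U \<subseteq> \<Omega> \<and> 0 < m \<and> continuous_on U G \<and>
        (\<forall>x\<in>U. GDERIV \<phi> x :> G x \<and> m \<le> norm (G x)))"

text \<open>\<^const>\<open>triangulation\<close> includes finiteness and conformity (two simplices meet in a common face).\<close>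

definition tetrahedral_mesh :: "(real^3) set \<Rightarrow> (real^3) set set \<Rightarrow> bool" where
  "tetrahedral_mesh \<Omega> \<T> \<longleftrightarrow>
     triangulation \<T> \<and> (\<forall>T\<in>\<T>. 3 simplex T) \<and> \<Union>\<T> = closure \<Omega>"

definition shape_regular :: "real \<Rightarrow> (real^3) set set \<Rightarrow> bool" where
  "shape_regular \<sigma> \<T> \<longleftrightarrow>
     (\<forall>T\<in>\<T>. \<exists>x r. 0 < r \<and> cball x r \<subseteq> T \<and> diameter T \<le> \<sigma> * r)"

definition mesh_size :: "(real^3) set set \<Rightarrow> real" where
  "mesh_size \<T> = Max (diameter ` \<T>)"

text \<open>\<open>\<T>\<^sub>h\<^sup>\<Gamma>\<close>; the domain \<open>\<Omega>\<^sub>h\<^sup>\<Gamma>\<close> is its union.\<close>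

definition cut_mesh :: "(real^3) set set \<Rightarrow> (real^3) set \<Rightarrow> (real^3) set set" where
  "cut_mesh \<T> \<Gamma> = {T \<in> \<T>. T \<inter> \<Gamma> \<noteq> {}}"


section \<open>Finite elements\<close>

text \<open>
  Finite element functions are total functions whose values outside \<open>\<Union>K\<close> are irrelevant: everything
  below depends only on their restriction to \<open>\<Union>K\<close>.
\<close>

definition p1_space :: "(real^3) set set \<Rightarrow> (real^3 \<Rightarrow> real) set" where
  "p1_space K = {v. continuous_on (\<Union>K) v \<and> (\<forall>T\<in>K. \<exists>g b. \<forall>x\<in>T. v x = g \<bullet> x + b)}"

definition p1_interpolant ::
    "(real^3) set set \<Rightarrow> (real^3 \<Rightarrow> real) \<Rightarrow> (real^3 \<Rightarrow> real) \<Rightarrow> bool" where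
  "p1_interpolant \<T> \<phi> \<phi>h \<longleftrightarrow>
     \<phi>h \<in> p1_space \<T> \<and> (\<forall>T\<in>\<T>. \<forall>x. x extreme_point_of T \<longrightarrow> \<phi>h x = \<phi> x)"

definition elem_grad :: "(real^3) set \<Rightarrow> (real^3 \<Rightarrow> real) \<Rightarrow> real^3 \<Rightarrow> real^3" where
  "elem_grad T v x = (THE g. (v has_derivative (\<lambda>y. y \<bullet> g)) (at x within T))"

text \<open>
  The elementwise gradient of a finite element function.  At a point shared by several tetrahedra one
  of them is selected, the same one for every function.  The choice does not matter: such points are
  null for the volume measure, and on the zero set of \<open>\<phi>h\<close> they are null for the surface measure
  unless a whole face lies in it; on such a face the tangential gradients from both sides coincide.
\<close>

definition fe_grad :: "(real^3) set set \<Rightarrow> (real^3 \<Rightarrow> real) \<Rightarrow> real^3 \<Rightarrow> real^3" where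
  "fe_grad K v x = elem_grad (SOME T. T \<in> K \<and> x \<in> T) v x"

text \<open>
  The zero level set is taken within the cut elements, where the finite element functions live.  No
  zeros are lost unless \<open>\<phi>\<close> vanishes on the boundary of the bulk domain: on an element where \<open>\<phi>\<close> has
  no zero, its interpolant has none either.
\<close>

definition discrete_surface :: "(real^3) set set \<Rightarrow> (real^3 \<Rightarrow> real) \<Rightarrow> (real^3) set" where
  "discrete_surface K \<phi>h = {x \<in> \<Union>K. \<phi>h x = 0}"

definition discrete_normal :: "(real^3) set set \<Rightarrow> (real^3 \<Rightarrow> real) \<Rightarrow> real^3 \<Rightarrow> real^3" where
  "discrete_normal K \<phi>h x = fe_grad K \<phi>h x /\<^sub>R norm (fe_grad K \<phi>h x)"

definition tangential_projection ::
    "(real^3) set set \<Rightarrow> (real^3 \<Rightarrow> real) \<Rightarrow> real^3 \<Rightarrow> real^3^3" where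
  "tangential_projection K \<phi>h x =
     mat 1 - (\<chi> i j. discrete_normal K \<phi>h x $ i * discrete_normal K \<phi>h x $ j)"

definition surface_grad ::
    "(real^3) set set \<Rightarrow> (real^3 \<Rightarrow> real) \<Rightarrow> (real^3 \<Rightarrow> real) \<Rightarrow> real^3 \<Rightarrow> real^3" where
  "surface_grad K \<phi>h v x = tangential_projection K \<phi>h x *v fe_grad K v x"

definition normal_deriv ::
    "(real^3) set set \<Rightarrow> (real^3 \<Rightarrow> real) \<Rightarrow> (real^3 \<Rightarrow> real) \<Rightarrow> real^3 \<Rightarrow> real" where
  "normal_deriv K \<phi>h v x = discrete_normal K \<phi>h x \<bullet> fe_grad K v x"


section \<open>The SAV-BDF1 scheme\<close>

definition f0 :: "real \<Rightarrow> real" where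
  "f0 c = 1 / 4 * c\<^sup>2 * (1 - c)\<^sup>2"

definition mobility :: "real \<Rightarrow> real" where
  "mobility c = c * (1 - c)"

text \<open>The integral is over the exact surface \<open>\<Gamma>\<close>, which is contained in \<open>\<Omega>\<^sub>h\<^sup>\<Gamma>\<close>.\<close>

definition E1 :: "(real^3) set \<Rightarrow> (real^3 \<Rightarrow> real) \<Rightarrow> real" where
  "E1 \<Gamma> c = (LINT x:\<Gamma>|surface_measure. f0 (c x))"

definition surface_inner ::
    "(real^3) set set \<Rightarrow> (real^3 \<Rightarrow> real) \<Rightarrow> (real^3 \<Rightarrow> 'b::real_inner) \<Rightarrow> (real^3 \<Rightarrow> 'b) \<Rightarrow> real" where
  "surface_inner K \<phi>h = l2_inner surface_measure (discrete_surface K \<phi>h)"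

definition surface_norm ::
    "(real^3) set set \<Rightarrow> (real^3 \<Rightarrow> real) \<Rightarrow> (real^3 \<Rightarrow> 'b::real_normed_vector) \<Rightarrow> real" where
  "surface_norm K \<phi>h = l2_norm surface_measure (discrete_surface K \<phi>h)"

definition bulk_norm :: "(real^3) set set \<Rightarrow> (real^3 \<Rightarrow> real) \<Rightarrow> real" where
  "bulk_norm K = l2_norm lborel (\<Union>K)"

definition sav_bdf1 ::
    "(real^3) set \<Rightarrow> (real^3) set set \<Rightarrow> (real^3 \<Rightarrow> real) \<Rightarrow> real \<Rightarrow> real \<Rightarrow> real \<Rightarrow> real \<Rightarrow>
     (nat \<Rightarrow> real^3 \<Rightarrow> real) \<Rightarrow> (nat \<Rightarrow> real^3 \<Rightarrow> real) \<Rightarrow> (nat \<Rightarrow> real) \<Rightarrow> bool" where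
  "sav_bdf1 \<Gamma> K \<phi>h h \<rho> \<epsilon> \<Delta>t c \<mu> r \<longleftrightarrow>
     c 0 \<in> p1_space K \<and>
     (\<forall>n. c (Suc n) \<in> p1_space K \<and> \<mu> (Suc n) \<in> p1_space K \<and>
       (\<forall>v\<in>p1_space K.
          \<rho> * surface_inner K \<phi>h (\<lambda>x. c (Suc n) x - c n x) v =
            - \<Delta>t * surface_inner K \<phi>h
                (\<lambda>x. mobility (c n x) *\<^sub>R surface_grad K \<phi>h (\<mu> (Suc n)) x) (surface_grad K \<phi>h v)
            - h * \<Delta>t * (LINT x:\<Union>K|lborel.
                normal_deriv K \<phi>h (\<mu> (Suc n)) x * normal_deriv K \<phi>h v x)) \<and>
       (\<forall>q\<in>p1_space K.
          surface_inner K \<phi>h (\<mu> (Suc n)) q =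
            r (Suc n) / sqrt (E1 \<Gamma> (c n)) * surface_inner K \<phi>h (\<lambda>x. deriv f0 (c n x)) q
            + \<epsilon>\<^sup>2 * surface_inner K \<phi>h (surface_grad K \<phi>h (c (Suc n))) (surface_grad K \<phi>h q)
            + inverse h * \<epsilon>\<^sup>2 * (LINT x:\<Union>K|lborel.
                normal_deriv K \<phi>h (c (Suc n)) x * normal_deriv K \<phi>h q x)) \<and>
       r (Suc n) - r n =
         1 / (2 * sqrt (E1 \<Gamma> (c n))) *
           surface_inner K \<phi>h (\<lambda>x. deriv f0 (c n x)) (\<lambda>x. c (Suc n) x - c n x))"

definition sav_energy ::
    "(real^3) set set \<Rightarrow> (real^3 \<Rightarrow> real) \<Rightarrow> real \<Rightarrow> real \<Rightarrow> (real^3 \<Rightarrow> real) \<Rightarrow> real \<Rightarrow> real" where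
  "sav_energy K \<phi>h h \<epsilon> c r =
     \<epsilon>\<^sup>2 / 2 * (surface_norm K \<phi>h (surface_grad K \<phi>h c))\<^sup>2 + \<bar>r\<bar>\<^sup>2
     + inverse h * \<epsilon>\<^sup>2 / 2 * (bulk_norm K (normal_deriv K \<phi>h c))\<^sup>2"

end

theory Submission
  imports Defs
begin

text \<open>
  The energy balance is the discrete counterpart of testing the Cahn--Hilliard system with the
  chemical potential and with the time derivative of the concentration.  Let \<open>d = c\<^sup>n\<^sup>+\<^sup>1 - c\<^sup>n\<close>.  Taking
  \<open>v = \<mu>\<^sup>n\<^sup>+\<^sup>1\<close> in the first equation expresses \<open>(d, \<mu>\<^sup>n\<^sup>+\<^sup>1)\<close> by the dissipation; taking \<open>q = d\<close> in the
  second expresses the same number by \<open>r\<^sup>n\<^sup>+\<^sup>1 / \<surd>E\<^sub>1 (f\<^sub>0', d)\<close> and by products of \<open>\<nabla>c\<^sup>n\<^sup>+\<^sup>1\<close> with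
  \<open>\<nabla>d\<close>.  The third equation turns the nonlinear term into \<open>2 r\<^sup>n\<^sup>+\<^sup>1 (r\<^sup>n\<^sup>+\<^sup>1 - r\<^sup>n)\<close>, and every remaining
  product is of the form \<open>2 a (a - b) = a\<^sup>2 - b\<^sup>2 + (a - b)\<^sup>2\<close>.  The resulting algebra is
  \<open>sav_step_energy_balance\<close>.  Energy decay follows because the dissipation is nonnegative as soon as
  the mobility is nonnegative on \<open>\<Gamma>\<^sub>h\<close>.

  The analytic content is that this identity may be integrated: the Bochner integral is additive
  only on integrable functions, so all gradient products have to be integrable over \<open>\<Gamma>\<^sub>h\<close> and over
  \<open>\<Omega>\<^sub>h\<^sup>\<Gamma>\<close>.  The value of a finite element gradient at \<open>x\<close> is determined by the set of tetrahedra that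
  contain \<open>x\<close>, hence gradient fields, the discrete normal and all expressions in them take finitely
  many values, on Borel pieces (\<open>set_integrable_elementwise_constant\<close>).  They are therefore
  integrable over every Borel set of finite measure.  That \<open>\<Gamma>\<^sub>h\<close> has finite area
  (\<open>finite_area_discrete_surface\<close>) follows from its being a finite union of bounded planar pieces:
  since \<open>\<nabla>\<phi>\<^sub>h\<close> does not vanish, the zero set in each tetrahedron lies in a plane.
\<close>


section \<open>Finite area of planar pieces\<close>

text \<open>
  The infimum ranges over sequences of sets, so a finite cover is enumerated and continued by empty
  sets, which have diameter zero.
\<close>

lemma hausdorff2_delta_le_finite_cover:
  assumes "finite J" and cover: "A \<subseteq> (\<Union>j\<in>J. U j)"
    and bdd: "\<And>j. j \<in> J \<Longrightarrow> bounded (U j)"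
    and diam: "\<And>j. j \<in> J \<Longrightarrow> diameter (U j) \<le> d"
    and "d \<le> \<delta>" "0 < \<delta>"
  shows "hausdorff2_delta \<delta> A \<le> ennreal (real (card J) * (pi / 4 * d\<^sup>2))"
proof -
  obtain f where f: "bij_betw f {0..<card J} J"
    using ex_bij_betw_nat_finite[OF \<open>finite J\<close>] by blast
  define V where "V i = (if i < card J then U (f i) else {})" for i
  have fJ: "f i \<in> J" if "i < card J" for i
    using f that by (auto simp: bij_betw_def)
  have "A \<subseteq> (\<Union>i. V i)"
  proof
    fix x assume "x \<in> A"
    then obtain j where "j \<in> J" "x \<in> U j" using cover by blast
    have "j \<in> f ` {0..<card J}" using bij_betw_imp_surj_on[OF f] \<open>j \<in> J\<close> by simp
    then obtain i where "i < card J" "f i = j" by auto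
    then have "x \<in> V i" using \<open>x \<in> U j\<close> by (simp add: V_def)
    then show "x \<in> (\<Union>i. V i)" by blast
  qed
  moreover have "bounded (V i) \<and> diameter (V i) \<le> \<delta>" for i
    using bdd[OF fJ[of i]] diam[OF fJ[of i]] \<open>d \<le> \<delta>\<close> \<open>0 < \<delta>\<close> by (auto simp: V_def)
  ultimately have "hausdorff2_delta \<delta> A \<le> (\<Sum>i. ennreal (pi / 4 * (diameter (V i))\<^sup>2))"
    unfolding hausdorff2_delta_def by (intro INF_lower) auto
  also have "\<dots> = (\<Sum>i<card J. ennreal (pi / 4 * (diameter (V i))\<^sup>2))"
    by (intro suminf_finite) (auto simp: V_def)
  also have "\<dots> \<le> (\<Sum>i<card J. ennreal (pi / 4 * d\<^sup>2))"
  proof (intro sum_mono ennreal_leI mult_left_mono power_mono)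
    fix i assume "i \<in> {..<card J}"
    then show "diameter (V i) \<le> d" "0 \<le> diameter (V i)"
      using diam[OF fJ[of i]] bdd[OF fJ[of i]] by (auto simp: V_def diameter_ge_0)
  qed auto
  also have "\<dots> = ennreal (real (card J) * (pi / 4 * d\<^sup>2))"
    by (simp add: ennreal_mult'[symmetric] ennreal_of_nat_eq_real_of_nat)
  finally show ?thesis .
qed

text \<open>
  On a plane whose normal has a nonzero \<open>k\<close>-th entry the \<open>k\<close>-th coordinate is a Lipschitz function of
  the other two, so differences of points are controlled by two coordinates.  This is why a planar set
  needs only quadratically many pieces in a grid cover.
\<close>

lemma norm_le_on_plane:
  fixes g z :: "real^3"
  assumes k: "g $ k \<noteq> 0" and plane: "g \<bullet> z = 0"
    and z: "\<And>i. i \<noteq> k \<Longrightarrow> \<bar>z $ i\<bar> \<le> t" and "0 \<le> t"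
  shows "norm z \<le> 3 * (1 + (\<Sum>i\<in>UNIV. \<bar>g $ i\<bar>) / \<bar>g $ k\<bar>) * t"
proof -
  define G where "G = (\<Sum>i\<in>UNIV. \<bar>g $ i\<bar>)"
  have G0: "0 \<le> G" by (simp add: G_def sum_nonneg)
  have "0 = (\<Sum>i\<in>UNIV. g $ i * z $ i)"
    using plane by (simp add: inner_vec_def)
  also have "\<dots> = g $ k * z $ k + (\<Sum>i\<in>UNIV - {k}. g $ i * z $ i)"
    by (simp add: sum.remove[of UNIV k])
  finally have "\<bar>g $ k\<bar> * \<bar>z $ k\<bar> = \<bar>\<Sum>i\<in>UNIV - {k}. g $ i * z $ i\<bar>"
    by (metis abs_minus_cancel abs_mult add_eq_0_iff)
  also have "\<dots> \<le> (\<Sum>i\<in>UNIV - {k}. \<bar>g $ i\<bar> * t)"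
    by (rule order_trans[OF sum_abs]) (auto simp: abs_mult intro!: sum_mono mult_left_mono z)
  also have "\<dots> \<le> (\<Sum>i\<in>UNIV. \<bar>g $ i\<bar> * t)"
    by (rule sum_mono2) (auto simp: \<open>0 \<le> t\<close>)
  also have "\<dots> = G * t" by (simp add: G_def sum_distrib_right)
  finally have zk: "\<bar>z $ k\<bar> \<le> G / \<bar>g $ k\<bar> * t"
    using k by (simp add: field_simps)
  have "\<bar>z $ i\<bar> \<le> (1 + G / \<bar>g $ k\<bar>) * t" for i
  proof (cases "i = k")
    case True
    then show ?thesis using zk \<open>0 \<le> t\<close> by (simp add: algebra_simps)
  next
    case False
    have "0 \<le> G / \<bar>g $ k\<bar> * t" using G0 \<open>0 \<le> t\<close> by simp
    then show ?thesis using z[OF False] unfolding distrib_right by linarith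
  qed
  then have "(\<Sum>i\<in>UNIV. \<bar>z $ i\<bar>) \<le> (\<Sum>i\<in>(UNIV::3 set). (1 + G / \<bar>g $ k\<bar>) * t)"
    by (intro sum_mono)
  then show ?thesis
    using norm_le_l1_cart[of z] by (simp add: G_def algebra_simps)
qed

text \<open>
  Grouping the points by the cell of width \<open>1 / N\<close> that contains their two free coordinates gives
  \<open>O(N\<^sup>2)\<close> pieces of diameter \<open>O(1 / N)\<close>.  The sum of the squared diameters is bounded independently
  of \<open>N\<close>, and \<open>N\<close> can be taken large for any prescribed \<open>\<delta>\<close>.
\<close>

lemma hausdorff2_outer_planar_finite:
  fixes g :: "real^3"
  assumes "g \<noteq> 0" and plane: "\<And>x. x \<in> A \<Longrightarrow> g \<bullet> x = \<beta>" and "bounded A"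
  shows "hausdorff2_outer A < \<infinity>"
proof -
  obtain k where k: "g $ k \<noteq> 0"
    using \<open>g \<noteq> 0\<close> by (auto simp: vec_eq_iff)
  define L where "L = 3 * (1 + (\<Sum>i\<in>UNIV. \<bar>g $ i\<bar>) / \<bar>g $ k\<bar>)"
  have L: "0 < L"
    unfolding L_def by (intro mult_pos_pos add_pos_nonneg divide_nonneg_nonneg sum_nonneg) auto
  obtain b where b: "\<And>x. x \<in> A \<Longrightarrow> norm x \<le> b"
    using \<open>bounded A\<close> by (auto simp: bounded_iff)
  define R where "R = nat \<lceil>b\<rceil> + 1"
  have R: "norm x \<le> real R" if "x \<in> A" for x
    using b[OF that] unfolding R_def by linarith
  have R1: "1 \<le> R" by (simp add: R_def)
  have "hausdorff2_delta \<delta> A \<le> ennreal (pi / 4 * (3 * R * L)\<^sup>2)" if "0 < \<delta>" for \<delta>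
  proof -
    \<comment> \<open>the grid width \<open>1 / N\<close> must make the diameters, at most \<open>L / N\<close>, no larger than \<open>\<delta>\<close>\<close>
    obtain N :: nat where N: "L / \<delta> < N" using reals_Archimedean2 by blast
    have N0: "0 < N" using N L \<open>0 < \<delta>\<close> by (metis divide_pos_pos of_nat_0_less_iff order.strict_trans)
    have LN: "L / N \<le> \<delta>"
      using N N0 \<open>0 < \<delta>\<close> by (simp add: field_simps)
    define J where "J = (UNIV - {k}) \<rightarrow>\<^sub>E {- int (R * N)..int (R * N)}"
    define U where "U j = {x \<in> A. \<forall>i\<in>UNIV - {k}. \<lfloor>N * x $ i\<rfloor> = j i}" for j :: "3 \<Rightarrow> int"
    have "finite J" unfolding J_def by (intro finite_PiE) auto
    have "card (UNIV - {k}) = 2" by (simp add: card_Diff_singleton)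
    then have cardJ: "card J = (2 * (R * N) + 1)\<^sup>2"
      unfolding J_def by (subst card_funcsetE) (simp_all del: of_nat_mult)
    have "A \<subseteq> (\<Union>j\<in>J. U j)"
    proof
      fix x assume x: "x \<in> A"
      define j where "j = restrict (\<lambda>i. \<lfloor>N * x $ i\<rfloor>) (UNIV - {k})"
      have "\<lfloor>N * x $ i\<rfloor> \<in> {- int (R * N)..int (R * N)}" for i
      proof -
        have "\<bar>x $ i\<bar> \<le> R" using component_le_norm_cart[of x i] R[OF x] by linarith
        then have "- real R \<le> x $ i" "x $ i \<le> real R" by linarith+
        then have "- real R * N \<le> x $ i * N" "x $ i * N \<le> real R * N"
          by (simp_all only: mult_right_mono of_nat_0_le_iff)
        then have "- real_of_int (int (R * N)) \<le> N * x $ i" "N * x $ i \<le> real_of_int (int (R * N))"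
          by (simp_all add: mult.commute)
        then show ?thesis by (simp only: atLeastAtMost_iff) linarith
      qed
      then have "j \<in> J" unfolding J_def j_def by auto
      moreover have "x \<in> U j" using x by (simp add: U_def j_def)
      ultimately show "x \<in> (\<Union>j\<in>J. U j)" by blast
    qed
    moreover have "bounded (U j)" for j
      by (rule bounded_subset[OF \<open>bounded A\<close>]) (auto simp: U_def)
    moreover have "diameter (U j) \<le> L / N" for j
    proof (rule diameter_le)
      show "U j \<noteq> {} \<or> 0 \<le> L / N" using L by simp
      fix x y assume x: "x \<in> U j" and y: "y \<in> U j"
      have "\<bar>(x - y) $ i\<bar> \<le> 1 / N" if "i \<noteq> k" for i
      proof -
        have "\<lfloor>N * x $ i\<rfloor> = \<lfloor>N * y $ i\<rfloor>" using x y that by (auto simp: U_def)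
        then have "\<bar>N * x $ i - N * y $ i\<bar> \<le> 1" by linarith
        moreover have "N * x $ i - N * y $ i = N * (x - y) $ i" by (simp add: right_diff_distrib)
        ultimately have "N * \<bar>(x - y) $ i\<bar> \<le> 1" by (simp add: abs_mult)
        then show ?thesis using N0 by (simp add: pos_le_divide_eq mult.commute)
      qed
      moreover have "g \<bullet> (x - y) = 0"
        using x y plane by (auto simp: U_def inner_diff_right)
      ultimately show "norm (x - y) \<le> L / N"
        using norm_le_on_plane[OF k, of "x - y" "1 / N"] by (simp add: L_def)
    qed
    ultimately have "hausdorff2_delta \<delta> A \<le> ennreal (real (card J) * (pi / 4 * (L / N)\<^sup>2))"
      by (intro hausdorff2_delta_le_finite_cover[where U=U]) (use \<open>finite J\<close> LN \<open>0 < \<delta>\<close> in auto)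
    also have "\<dots> \<le> ennreal (real ((3 * (R * N))\<^sup>2) * (pi / 4 * (L / N)\<^sup>2))"
    proof (intro ennreal_leI mult_right_mono)
      \<comment> \<open>\<open>1 \<le> R * N\<close> absorbs the \<open>+ 1\<close> in the number of cells, so that \<open>N\<close> cancels\<close>
      have "1 \<le> R * N" using R1 N0 by simp
      then have "2 * (R * N) + 1 \<le> 3 * (R * N)" by linarith
      then show "real (card J) \<le> real ((3 * (R * N))\<^sup>2)"
        unfolding cardJ of_nat_le_iff by (rule power_mono) simp
    qed simp
    also have "real ((3 * (R * N))\<^sup>2) * (pi / 4 * (L / N)\<^sup>2) = pi / 4 * (3 * R * L)\<^sup>2"
      using N0 by (simp add: power2_eq_square field_simps)
    finally show ?thesis .
  qed
  then have "hausdorff2_outer A \<le> ennreal (pi / 4 * (3 * R * L)\<^sup>2)"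
    unfolding hausdorff2_outer_def by (intro SUP_least) auto
  then show ?thesis by (simp add: le_less_trans)
qed

lemma sets_surface_measure: "sets surface_measure = sets borel"
  unfolding surface_measure_def
  using sets.sets_measure_of_eq[of "borel :: (real^3) measure"] by (simp only: space_borel)

text \<open>
  \<^const>\<open>measure_of\<close> yields the given set function where it is a measure and the zero measure
  otherwise; in both cases the outer measure is an upper bound.  It suffices for finiteness of area.
\<close>

lemma emeasure_surface_measure_le: "emeasure surface_measure A \<le> hausdorff2_outer A"
  unfolding surface_measure_def emeasure_measure_of_conv by (simp only: zero_le order_refl split: if_split) simp


section \<open>Gradients on tetrahedra\<close>

text \<open>
  Two candidate gradients at \<open>x\<close> agree along every segment from \<open>x\<close> to another point of \<open>T\<close>.  If they
  differed, \<open>T\<close> would lie in a plane, which is impossible for a tetrahedron.  This argument covers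
  boundary points, where the derivative within \<open>T\<close> is only one-sided.
\<close>

lemma elem_grad_affine:
  assumes T: "3 simplex T" and x: "x \<in> T" and v: "\<And>y. y \<in> T \<Longrightarrow> v y = g \<bullet> y + b"
  shows "elem_grad T v x = g"
  unfolding elem_grad_def
proof (rule the_equality)
  have "((\<lambda>y. g \<bullet> y + b) has_derivative (\<lambda>y. y \<bullet> g)) (at x within T)"
    by (auto intro!: derivative_eq_intros simp: inner_commute)
  then show "(v has_derivative (\<lambda>y. y \<bullet> g)) (at x within T)"
    by (rule has_derivative_transform[rotated 2]) (use x v in auto)
  fix g' assume g': "(v has_derivative (\<lambda>y. y \<bullet> g')) (at x within T)"
  have "convex T" using T convex_simplex by blast
  have "(g' - g) \<bullet> (y - x) = 0" if y: "y \<in> T" for y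
  proof -
    \<comment> \<open>restrict both derivatives to the segment from \<open>x\<close> to \<open>y\<close>, where they are unique\<close>
    define p where "p t = x + t *\<^sub>R (y - x)" for t :: real
    have p: "p ` {0..1} \<subseteq> T"
      using \<open>convex T\<close> x y by (auto simp: p_def convex_alt algebra_simps)
    have "(p has_derivative (\<lambda>t. t *\<^sub>R (y - x))) (at 0 within {0..1})"
      unfolding p_def by (auto intro!: derivative_eq_intros)
    moreover have "(v has_derivative (\<lambda>y. y \<bullet> g')) (at (p 0) within p ` {0..1})"
      using has_derivative_subset[OF g' p] by (simp add: p_def)
    ultimately have "(v \<circ> p has_derivative (\<lambda>y. y \<bullet> g') \<circ> (\<lambda>t. t *\<^sub>R (y - x))) (at 0 within {0..1})"
      by (rule diff_chain_within)
    then have 1: "(v \<circ> p has_vector_derivative (y - x) \<bullet> g') (at 0 within {0..1})"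
      by (simp add: has_vector_derivative_def o_def)
    have aff: "((\<lambda>t. g \<bullet> p t + b) has_vector_derivative (y - x) \<bullet> g) (at 0 within {0..1})"
      unfolding p_def has_vector_derivative_def
      by (auto intro!: derivative_eq_intros simp: inner_commute)
    have "(v \<circ> p) t = g \<bullet> p t + b" if "t \<in> {0..1}" for t
      using v[OF subsetD[OF p imageI[OF that]]] by simp
    then have 2: "(v \<circ> p has_vector_derivative (y - x) \<bullet> g) (at 0 within {0..1})"
      by (intro has_vector_derivative_transform[OF _ _ aff]) simp_all
    have "(y - x) \<bullet> g' = (y - x) \<bullet> g"
      by (rule vector_derivative_unique_within_closed_interval[of 0 1 0 "v \<circ> p"])
        (use 1 2 in \<open>simp_all add: box_real\<close>)
    then show ?thesis by (simp add: inner_diff_left inner_diff_right inner_commute)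
  qed
  then have "T \<subseteq> {y. (g' - g) \<bullet> y = (g' - g) \<bullet> x}" by (auto simp: inner_diff_right)
  then have le: "aff_dim T \<le> aff_dim {y. (g' - g) \<bullet> y = (g' - g) \<bullet> x}" by (rule aff_dim_subset)
  have "aff_dim T = 3" using aff_dim_simplex[OF T] by simp
  then show "g' = g" using le aff_dim_hyperplane[of "g' - g"] by (cases "g' = g") auto
qed

lemma selected_element:
  assumes "x \<in> \<Union>K"
  shows "(SOME T. T \<in> K \<and> x \<in> T) \<in> K" "x \<in> (SOME T. T \<in> K \<and> x \<in> T)"
  using assms someI_ex[of "\<lambda>T. T \<in> K \<and> x \<in> T"] by auto

lemma fe_grad_diff:
  assumes K: "\<And>T. T \<in> K \<Longrightarrow> 3 simplex T" and v: "v \<in> p1_space K" and w: "w \<in> p1_space K"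
    and x: "x \<in> \<Union>K"
  shows "fe_grad K (\<lambda>y. v y - w y) x = fe_grad K v x - fe_grad K w x"
proof -
  define T where "T = (SOME T. T \<in> K \<and> x \<in> T)"
  have T: "T \<in> K" "x \<in> T" using selected_element[OF x] by (simp_all add: T_def)
  obtain g b where v': "\<And>y. y \<in> T \<Longrightarrow> v y = g \<bullet> y + b" using v T by (auto simp: p1_space_def)
  obtain g' b' where w': "\<And>y. y \<in> T \<Longrightarrow> w y = g' \<bullet> y + b'" using w T by (auto simp: p1_space_def)
  have "elem_grad T (\<lambda>y. v y - w y) x = g - g'"
    by (rule elem_grad_affine[OF K[OF T(1)] T(2), where b = "b - b'"]) (simp add: v' w' inner_diff_left)
  then show ?thesis
    using elem_grad_affine[OF K[OF T(1)] T(2), of v, OF v'] elem_grad_affine[OF K[OF T(1)] T(2), of w, OF w']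
    by (simp add: fe_grad_def T_def)
qed

lemma p1_space_diff:
  assumes "v \<in> p1_space K" "w \<in> p1_space K"
  shows "(\<lambda>x. v x - w x) \<in> p1_space K"
  unfolding p1_space_def
proof (intro CollectI conjI ballI)
  show "continuous_on (\<Union>K) (\<lambda>x. v x - w x)"
    using assms by (auto simp: p1_space_def intro: continuous_on_diff)
  fix T assume T: "T \<in> K"
  obtain g b where v': "\<And>y. y \<in> T \<Longrightarrow> v y = g \<bullet> y + b" using assms(1) T by (auto simp: p1_space_def)
  obtain g' b' where w': "\<And>y. y \<in> T \<Longrightarrow> w y = g' \<bullet> y + b'" using assms(2) T by (auto simp: p1_space_def)
  show "\<exists>g b. \<forall>x\<in>T. v x - w x = g \<bullet> x + b"
    by (rule exI[of _ "g - g'"], rule exI[of _ "b - b'"]) (simp add: v' w' inner_diff_left)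
qed

lemma surface_grad_diff:
  assumes "\<And>T. T \<in> K \<Longrightarrow> 3 simplex T" "v \<in> p1_space K" "w \<in> p1_space K" "x \<in> \<Union>K"
  shows "surface_grad K \<phi>h (\<lambda>y. v y - w y) x = surface_grad K \<phi>h v x - surface_grad K \<phi>h w x"
  using fe_grad_diff[OF assms] by (simp add: surface_grad_def matrix_vector_mult_diff_distrib)

lemma normal_deriv_diff:
  assumes "\<And>T. T \<in> K \<Longrightarrow> 3 simplex T" "v \<in> p1_space K" "w \<in> p1_space K" "x \<in> \<Union>K"
  shows "normal_deriv K \<phi>h (\<lambda>y. v y - w y) x = normal_deriv K \<phi>h v x - normal_deriv K \<phi>h w x"
  using fe_grad_diff[OF assms] by (simp add: normal_deriv_def inner_diff_right)


section \<open>Integrability of elementwise constant fields\<close>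

text \<open>
  The value may depend on the whole set of members containing \<open>x\<close>, not on one member alone.  At a point
  shared by several tetrahedra the elementwise gradient is that of one of them, chosen by
  \<^const>\<open>Eps\<close> from the set of all that contain the point, so it is a function of this set.
\<close>

definition elementwise_constant :: "'a set set \<Rightarrow> ('a \<Rightarrow> 'b) \<Rightarrow> bool" where
  "elementwise_constant K f \<longleftrightarrow> (\<exists>F. \<forall>x\<in>\<Union>K. f x = F {T \<in> K. x \<in> T})"

lemma elementwise_constantI: "(\<And>x. x \<in> \<Union>K \<Longrightarrow> f x = F {T \<in> K. x \<in> T}) \<Longrightarrow> elementwise_constant K f"
  unfolding elementwise_constant_def by (intro exI[of _ F] ballI)

lemma elementwise_constant_compose2:
  assumes "elementwise_constant K f" "elementwise_constant K g"
  shows "elementwise_constant K (\<lambda>x. H (f x) (g x))"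
proof -
  obtain F where F: "\<forall>x\<in>\<Union>K. f x = F {T \<in> K. x \<in> T}"
    using assms(1) unfolding elementwise_constant_def by (elim exE)
  obtain G where "\<forall>x\<in>\<Union>K. g x = G {T \<in> K. x \<in> T}"
    using assms(2) unfolding elementwise_constant_def by (elim exE)
  with F show ?thesis
    by (intro elementwise_constantI[where F = "\<lambda>S. H (F S) (G S)"]) auto
qed

lemma elementwise_constant_fe_grad:
  assumes K: "\<And>T. T \<in> K \<Longrightarrow> 3 simplex T" and v: "v \<in> p1_space K"
  shows "elementwise_constant K (fe_grad K v)"
proof -
  have "\<exists>g. \<forall>x\<in>T. elem_grad T v x = g" if T: "T \<in> K" for T
  proof -
    obtain g b where "\<And>y. y \<in> T \<Longrightarrow> v y = g \<bullet> y + b" using v T by (auto simp: p1_space_def)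
    then have "\<forall>x\<in>T. elem_grad T v x = g" using elem_grad_affine[OF K[OF T]] by simp
    then show ?thesis by blast
  qed
  then obtain G where G: "\<And>T x. T \<in> K \<Longrightarrow> x \<in> T \<Longrightarrow> elem_grad T v x = G T" by metis
  show ?thesis
  proof (rule elementwise_constantI[where F = "\<lambda>S. G (SOME T. T \<in> S)"])
    fix x assume "x \<in> \<Union>K"
    from selected_element[OF this] show "fe_grad K v x = G (SOME T. T \<in> {T \<in> K. x \<in> T})"
      by (simp add: fe_grad_def G)
  qed
qed

lemma elementwise_constant_surface_grad:
  assumes "\<And>T. T \<in> K \<Longrightarrow> 3 simplex T" "\<phi>h \<in> p1_space K" "v \<in> p1_space K"
  shows "elementwise_constant K (surface_grad K \<phi>h v)"
  unfolding surface_grad_def tangential_projection_def discrete_normal_def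
  by (rule elementwise_constant_compose2[OF elementwise_constant_fe_grad elementwise_constant_fe_grad,
        where H = "\<lambda>n g. (mat 1 - (\<chi> i j. (n /\<^sub>R norm n) $ i * (n /\<^sub>R norm n) $ j)) *v g"])
    (use assms in auto)

lemma elementwise_constant_normal_deriv:
  assumes "\<And>T. T \<in> K \<Longrightarrow> 3 simplex T" "\<phi>h \<in> p1_space K" "v \<in> p1_space K"
  shows "elementwise_constant K (normal_deriv K \<phi>h v)"
  unfolding normal_deriv_def discrete_normal_def
  by (rule elementwise_constant_compose2[OF elementwise_constant_fe_grad elementwise_constant_fe_grad,
        where H = "\<lambda>n g. (n /\<^sub>R norm n) \<bullet> g"])
    (use assms in auto)

text \<open>
  \<open>A\<close> splits into the finitely many measurable sets of points that lie in exactly the members of \<open>S\<close>,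
  for \<open>S \<subseteq> K\<close>.  On each of them the function is constant.
\<close>

lemma set_integrable_elementwise_constant:
  fixes f :: "'a \<Rightarrow> 'b::{banach, second_countable_topology}"
  assumes f: "elementwise_constant K f" and "finite K" and K: "\<And>T. T \<in> K \<Longrightarrow> T \<in> sets M"
    and A: "A \<in> sets M" "A \<subseteq> \<Union>K" and fin: "emeasure M A < \<infinity>"
  shows "set_integrable M A f"
proof -
  obtain F where F: "\<And>x. x \<in> \<Union>K \<Longrightarrow> f x = F {T \<in> K. x \<in> T}"
    using f by (auto simp: elementwise_constant_def)
  define C where "C S = {x \<in> A. {T \<in> K. x \<in> T} = S}" for S
  have C: "C S \<in> sets M" if "S \<in> Pow K" for S
  proof -
    have C_eq: "C S = A - ((\<Union>T\<in>S. A - T) \<union> (\<Union>T\<in>K - S. T))"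
      using that by (auto simp: C_def)
    have "finite S" using that \<open>finite K\<close> by (auto intro: finite_subset)
    then show ?thesis
      unfolding C_eq using that A K \<open>finite K\<close>
      by (intro sets.Diff sets.Un sets.finite_UN) auto
  qed
  have "integrable M (\<lambda>x. \<Sum>S\<in>Pow K. indicator (C S) x *\<^sub>R F S)"
  proof (intro Bochner_Integration.integrable_sum)
    fix S assume S: "S \<in> Pow K"
    have "emeasure M (C S) \<le> emeasure M A"
      by (rule emeasure_mono) (auto simp: C_def A)
    then have "emeasure M (C S) < \<infinity>" using fin by (rule le_less_trans)
    then show "integrable M (\<lambda>x. indicator (C S) x *\<^sub>R F S)"
      using C[OF S] by simp
  qed
  moreover have "(\<Sum>S\<in>Pow K. indicator (C S) x *\<^sub>R F S) = indicator A x *\<^sub>R f x" for x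
  proof (cases "x \<in> A")
    case True
    have "(\<Sum>S\<in>Pow K. indicator (C S) x *\<^sub>R F S)
        = (\<Sum>S\<in>Pow K. if S = {T \<in> K. x \<in> T} then F S else 0)"
      using True by (intro sum.cong) (auto simp: C_def)
    also have "\<dots> = f x"
      using F[OF subsetD[OF A(2) True]] \<open>finite K\<close> by (subst sum.delta) auto
    finally show ?thesis using True by simp
  qed (auto simp: C_def)
  ultimately show ?thesis by (simp add: set_integrable_def)
qed


text \<open>
  The gradient condition excludes that \<open>\<phi>h\<close> vanishes on a whole tetrahedron, which would have
  infinite area.
\<close>

lemma finite_area_discrete_surface:
  assumes "finite K" and K: "\<And>T. T \<in> K \<Longrightarrow> 3 simplex T" and \<phi>h: "\<phi>h \<in> p1_space K"
    and nz: "\<And>T x. T \<in> K \<Longrightarrow> x \<in> T \<Longrightarrow> elem_grad T \<phi>h x \<noteq> 0"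
  shows "discrete_surface K \<phi>h \<in> sets borel"
    and "emeasure surface_measure (discrete_surface K \<phi>h) < \<infinity>"
proof -
  have cpt: "compact T" if "T \<in> K" for T using K[OF that] compact_simplex by blast
  have closed: "closed (\<Union>K)" using \<open>finite K\<close> cpt by (intro closed_Union) (auto intro: compact_imp_closed)
  have "closed (discrete_surface K \<phi>h)"
    unfolding discrete_surface_def
    by (rule continuous_closed_preimage_constant) (use \<phi>h closed in \<open>simp_all add: p1_space_def\<close>)
  then show 1: "discrete_surface K \<phi>h \<in> sets borel" by simp
  define P where "P T = T \<inter> discrete_surface K \<phi>h" for T
  have P: "P T \<in> sets surface_measure" if "T \<in> K" for T
    using 1 compact_imp_closed[OF cpt[OF that]] by (simp add: P_def sets_surface_measure)
  have "emeasure surface_measure (P T) < \<infinity>" if T: "T \<in> K" for T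
  proof (cases "P T = {}")
    case False
    then obtain x where x: "x \<in> T" by (auto simp: P_def)
    obtain g b where g: "\<And>y. y \<in> T \<Longrightarrow> \<phi>h y = g \<bullet> y + b" using \<phi>h T by (auto simp: p1_space_def)
    have "g \<noteq> 0" using nz[OF T x] elem_grad_affine[OF K[OF T] x g] by simp
    moreover have "g \<bullet> y = - b" if "y \<in> P T" for y
      using that g[of y] by (auto simp: P_def discrete_surface_def)
    moreover have "bounded (P T)"
      using compact_imp_bounded[OF cpt[OF T]] by (auto simp: P_def)
    ultimately have "hausdorff2_outer (P T) < \<infinity>" by (rule hausdorff2_outer_planar_finite)
    then show ?thesis using emeasure_surface_measure_le by (rule le_less_trans[rotated])
  qed simp
  then have "(\<Sum>T\<in>K. emeasure surface_measure (P T)) < \<infinity>"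
    using \<open>finite K\<close> by (simp add: less_top)
  moreover have "emeasure surface_measure (\<Union>T\<in>K. P T) \<le> (\<Sum>T\<in>K. emeasure surface_measure (P T))"
    using \<open>finite K\<close> P by (intro emeasure_subadditive_finite) auto
  moreover have "(\<Union>T\<in>K. P T) = discrete_surface K \<phi>h" by (auto simp: P_def discrete_surface_def)
  ultimately show "emeasure surface_measure (discrete_surface K \<phi>h) < \<infinity>" by simp
qed


section \<open>The energy identity\<close>

lemma l2_norm_square: "(l2_norm M A u)\<^sup>2 = l2_inner M A u u"
proof -
  have "0 \<le> (LINT x:A|M. (norm (u x))\<^sup>2)"
    unfolding set_lebesgue_integral_def by (intro Bochner_Integration.integral_nonneg) auto
  then show ?thesis by (simp add: l2_norm_def l2_inner_def power2_norm_eq_inner)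
qed

lemma l2_inner_commute: "l2_inner M A u v = l2_inner M A v u"
  by (simp add: l2_inner_def inner_commute)

lemma l2_inner_nonneg:
  assumes "\<And>x. x \<in> A \<Longrightarrow> 0 \<le> u x \<bullet> v x"
  shows "0 \<le> l2_inner M A u v"
  unfolding l2_inner_def set_lebesgue_integral_def
  by (intro Bochner_Integration.integral_nonneg) (use assms in \<open>auto simp: indicator_def\<close>)

lemma l2_inner_increment:
  fixes u w :: "'a \<Rightarrow> 'b::real_inner"
  assumes int: "set_integrable M A (\<lambda>x. u x \<bullet> u x)" "set_integrable M A (\<lambda>x. w x \<bullet> w x)"
      "set_integrable M A (\<lambda>x. (u x - w x) \<bullet> (u x - w x))"
  shows "2 * l2_inner M A u (\<lambda>x. u x - w x)
    = (l2_norm M A u)\<^sup>2 - (l2_norm M A w)\<^sup>2 + (l2_norm M A (\<lambda>x. u x - w x))\<^sup>2"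
proof -
  have "2 * l2_inner M A u (\<lambda>x. u x - w x)
      = (LINT x:A|M. u x \<bullet> u x - w x \<bullet> w x + (u x - w x) \<bullet> (u x - w x))"
    unfolding l2_inner_def set_integral_mult_right[symmetric]
    by (simp add: algebra_simps inner_commute)
  also have "\<dots> = l2_inner M A u u - l2_inner M A w w + l2_inner M A (\<lambda>x. u x - w x) (\<lambda>x. u x - w x)"
    unfolding l2_inner_def using int by (simp add: set_integral_add set_integral_diff)
  finally show ?thesis by (simp add: l2_norm_square)
qed

text \<open>
  The increment \<open>d\<close> is kept apart from \<open>u - w\<close> for fields such as the gradient of a difference,
  which agrees with the difference of the gradients on \<open>\<Union>K\<close> but is arbitrary elsewhere.
\<close>

lemma l2_inner_increment_elementwise_constant:
  fixes u w d :: "'a \<Rightarrow> 'b::real_inner"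
  assumes u: "elementwise_constant K u" and w: "elementwise_constant K w"
    and d: "\<And>x. x \<in> \<Union>K \<Longrightarrow> d x = u x - w x"
    and K: "finite K" "\<And>T. T \<in> K \<Longrightarrow> T \<in> sets M"
    and A: "A \<in> sets M" "A \<subseteq> \<Union>K" "emeasure M A < \<infinity>"
  shows "2 * l2_inner M A u d
    = (l2_norm M A u)\<^sup>2 - (l2_norm M A w)\<^sup>2 + (l2_norm M A (\<lambda>x. u x - w x))\<^sup>2"
proof -
  have "l2_inner M A u d = l2_inner M A u (\<lambda>x. u x - w x)"
    unfolding l2_inner_def using A by (intro set_lebesgue_integral_cong) (auto simp: d[OF subsetD[OF A(2)]])
  moreover have "set_integrable M A (\<lambda>x. H (u x) (w x))" for H :: "'b \<Rightarrow> 'b \<Rightarrow> real"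
    by (rule set_integrable_elementwise_constant[OF elementwise_constant_compose2[OF u w] K A])
  note this[of "\<lambda>a b. a \<bullet> a"] this[of "\<lambda>a b. b \<bullet> b"] this[of "\<lambda>a b. (a - b) \<bullet> (a - b)"]
  ultimately show ?thesis using l2_inner_increment[of M A u w] by simp
qed

text \<open>
  One time step with all integrals abstracted to numbers: \<open>D\<close> is the product of the increment with the
  new potential, \<open>m\<close> and \<open>p\<close> are the tangential and normal dissipation, \<open>F\<close> is the nonlinear term,
  \<open>s\<close> is \<open>\<surd>E\<^sub>1\<close>, and \<open>a\<close>, \<open>b\<close> are the surface and bulk products of the new gradient with its
  increment.  Equating the two expressions for \<open>D\<close> eliminates the potential.
\<close>

lemma sav_step_energy_balance:
  fixes \<rho> \<Delta>t h \<epsilon> s r r' :: real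
  assumes "\<rho> > 0" "s > 0"
    and mass: "\<rho> * D = - \<Delta>t * m - h * \<Delta>t * p"
    and potential: "D = r' / s * F + \<epsilon>\<^sup>2 * a + inverse h * \<epsilon>\<^sup>2 * b"
    and auxiliary: "r' - r = 1 / (2 * s) * F"
    and a: "2 * a = a1 - a0 + a2" and b: "2 * b = b1 - b0 + b2"
  shows "((\<epsilon>\<^sup>2 / 2 * a1 + \<bar>r'\<bar>\<^sup>2 + inverse h * \<epsilon>\<^sup>2 / 2 * b1)
      - (\<epsilon>\<^sup>2 / 2 * a0 + \<bar>r\<bar>\<^sup>2 + inverse h * \<epsilon>\<^sup>2 / 2 * b0))
      + \<epsilon>\<^sup>2 / 2 * a2 + \<bar>r' - r\<bar>\<^sup>2 + inverse h * \<epsilon>\<^sup>2 / 2 * b2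
    = - (\<Delta>t / \<rho>) * m - h * \<Delta>t / \<rho> * p"
proof -
  have "r' / s * F = 2 * r' * (r' - r)" using auxiliary \<open>s > 0\<close> by (simp add: field_simps)
  also have "\<dots> = r'\<^sup>2 - r\<^sup>2 + (r' - r)\<^sup>2" by (simp add: power2_eq_square algebra_simps)
  finally have rr: "r' / s * F = r'\<^sup>2 - r\<^sup>2 + (r' - r)\<^sup>2" .
  have a': "a = (a1 - a0 + a2) / 2" and b': "b = (b1 - b0 + b2) / 2" using a b by simp_all
  have "D = - (\<Delta>t / \<rho>) * m - h * \<Delta>t / \<rho> * p"
    using mass \<open>\<rho> > 0\<close> by (simp add: field_simps)
  moreover have "((\<epsilon>\<^sup>2 / 2 * a1 + \<bar>r'\<bar>\<^sup>2 + inverse h * \<epsilon>\<^sup>2 / 2 * b1)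
      - (\<epsilon>\<^sup>2 / 2 * a0 + \<bar>r\<bar>\<^sup>2 + inverse h * \<epsilon>\<^sup>2 / 2 * b0))
      + \<epsilon>\<^sup>2 / 2 * a2 + \<bar>r' - r\<bar>\<^sup>2 + inverse h * \<epsilon>\<^sup>2 / 2 * b2 = D"
    unfolding potential rr a' b' by (simp add: algebra_simps add_divide_distrib diff_divide_distrib)
  ultimately show ?thesis by simp
qed

theorem theorem3p1:
  fixes \<Omega> \<Gamma> :: "(real^3) set"
    and \<T> K :: "(real^3) set set"
    and \<phi> \<phi>h :: "real^3 \<Rightarrow> real"
    and \<sigma> h \<rho> \<epsilon> \<Delta>t :: real
    and c \<mu> :: "nat \<Rightarrow> real^3 \<Rightarrow> real"
    and r :: "nat \<Rightarrow> real"
  assumes bulk: "open \<Omega>" "connected \<Omega>" "bounded \<Omega>"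
    and surface: "level_set_surface \<Omega> \<phi> \<Gamma>"
    and mesh: "tetrahedral_mesh \<Omega> \<T>" "shape_regular \<sigma> \<T>"
    and h: "h = mesh_size \<T>" "0 < h"
    and K: "K = cut_mesh \<T> \<Gamma>"
    and interpolant: "p1_interpolant \<T> \<phi> \<phi>h"
    and normal_defined: "\<forall>T\<in>K. \<forall>x\<in>T. elem_grad T \<phi>h x \<noteq> 0"
    and constants: "0 < \<rho>" "0 < \<epsilon>" "0 < \<Delta>t"
    and E1_pos: "\<forall>n. 0 < E1 \<Gamma> (c n)"
    and scheme: "sav_bdf1 \<Gamma> K \<phi>h h \<rho> \<epsilon> \<Delta>t c \<mu> r"
  shows
    "(\<forall>n. (sav_energy K \<phi>h h \<epsilon> (c (Suc n)) (r (Suc n)) - sav_energy K \<phi>h h \<epsilon> (c n) (r n))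
        + \<epsilon>\<^sup>2 / 2 * (surface_norm K \<phi>h
            (\<lambda>x. surface_grad K \<phi>h (c (Suc n)) x - surface_grad K \<phi>h (c n) x))\<^sup>2
        + \<bar>r (Suc n) - r n\<bar>\<^sup>2
        + inverse h * \<epsilon>\<^sup>2 / 2 *
            (bulk_norm K (normal_deriv K \<phi>h (\<lambda>x. c (Suc n) x - c n x)))\<^sup>2
      = - (\<Delta>t / \<rho>) * surface_inner K \<phi>h
            (\<lambda>x. mobility (c n x) *\<^sub>R surface_grad K \<phi>h (\<mu> (Suc n)) x)
            (surface_grad K \<phi>h (\<mu> (Suc n)))
        - h * \<Delta>t / \<rho> * (bulk_norm K (normal_deriv K \<phi>h (\<mu> (Suc n))))\<^sup>2)
    \<and>
    (\<forall>n. (\<forall>x\<in>discrete_surface K \<phi>h. 0 \<le> mobility (c n x)) \<longrightarrow>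
        sav_energy K \<phi>h h \<epsilon> (c (Suc n)) (r (Suc n)) \<le> sav_energy K \<phi>h h \<epsilon> (c n) (r n))"
proof -
  have "finite \<T>" and simplex: "\<And>T. T \<in> \<T> \<Longrightarrow> 3 simplex T"
    using mesh(1) by (auto simp: tetrahedral_mesh_def triangulation_def)
  have "K \<subseteq> \<T>" by (auto simp: K cut_mesh_def)
  then have "finite K" using \<open>finite \<T>\<close> finite_subset by blast
  have K3: "3 simplex T" if "T \<in> K" for T using that \<open>K \<subseteq> \<T>\<close> simplex by blast
  have cpt: "compact T" if "T \<in> K" for T using K3[OF that] compact_simplex by blast
  have KB: "T \<in> sets borel" if "T \<in> K" for T by (rule borel_compact[OF cpt[OF that]])
  have \<phi>h: "\<phi>h \<in> p1_space K"
    using interpolant \<open>K \<subseteq> \<T>\<close> continuous_on_subset[OF _ Union_mono[OF \<open>K \<subseteq> \<T>\<close>]]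
    unfolding p1_interpolant_def p1_space_def by blast
  have nz: "\<And>T x. T \<in> K \<Longrightarrow> x \<in> T \<Longrightarrow> elem_grad T \<phi>h x \<noteq> 0" using normal_defined by blast
  note area = finite_area_discrete_surface[OF \<open>finite K\<close> K3 \<phi>h nz]
  have "compact (\<Union>K)" using \<open>finite K\<close> cpt by (intro compact_Union) auto
  then have volume: "\<Union>K \<in> sets lborel" "emeasure lborel (\<Union>K) < \<infinity>"
    using borel_compact[of "\<Union>K"] emeasure_compact_finite[of "\<Union>K"] by simp_all
  have c: "c n \<in> p1_space K" for n using scheme by (cases n) (auto simp: sav_bdf1_def)
  have \<mu>: "\<mu> (Suc n) \<in> p1_space K" for n using scheme by (auto simp: sav_bdf1_def)
  have surface_increment:
    "2 * surface_inner K \<phi>h (surface_grad K \<phi>h v) (surface_grad K \<phi>h (\<lambda>x. v x - w x))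
      = (surface_norm K \<phi>h (surface_grad K \<phi>h v))\<^sup>2 - (surface_norm K \<phi>h (surface_grad K \<phi>h w))\<^sup>2
        + (surface_norm K \<phi>h (\<lambda>x. surface_grad K \<phi>h v x - surface_grad K \<phi>h w x))\<^sup>2"
    if v: "v \<in> p1_space K" and w: "w \<in> p1_space K" for v w
    unfolding surface_inner_def surface_norm_def
    by (rule l2_inner_increment_elementwise_constant[OF
          elementwise_constant_surface_grad[OF K3 \<phi>h v] elementwise_constant_surface_grad[OF K3 \<phi>h w]
          surface_grad_diff[OF K3 v w] \<open>finite K\<close>])
      (use area KB in \<open>auto simp: sets_surface_measure discrete_surface_def\<close>)
  have bulk_increment:
    "2 * (LINT x:\<Union>K|lborel. normal_deriv K \<phi>h v x * normal_deriv K \<phi>h (\<lambda>x. v x - w x) x)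
      = (bulk_norm K (normal_deriv K \<phi>h v))\<^sup>2 - (bulk_norm K (normal_deriv K \<phi>h w))\<^sup>2
        + (bulk_norm K (normal_deriv K \<phi>h (\<lambda>x. v x - w x)))\<^sup>2"
    if v: "v \<in> p1_space K" and w: "w \<in> p1_space K" for v w
  proof -
    have "2 * l2_inner lborel (\<Union>K) (normal_deriv K \<phi>h v) (normal_deriv K \<phi>h (\<lambda>x. v x - w x))
      = (bulk_norm K (normal_deriv K \<phi>h v))\<^sup>2 - (bulk_norm K (normal_deriv K \<phi>h w))\<^sup>2
        + (bulk_norm K (\<lambda>x. normal_deriv K \<phi>h v x - normal_deriv K \<phi>h w x))\<^sup>2"
      unfolding bulk_norm_def
      by (rule l2_inner_increment_elementwise_constant[OF
            elementwise_constant_normal_deriv[OF K3 \<phi>h v] elementwise_constant_normal_deriv[OF K3 \<phi>h w]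
            normal_deriv_diff[OF K3 v w] \<open>finite K\<close>])
        (use volume KB in auto)
    moreover have "bulk_norm K (\<lambda>x. normal_deriv K \<phi>h v x - normal_deriv K \<phi>h w x)
        = bulk_norm K (normal_deriv K \<phi>h (\<lambda>x. v x - w x))"
      unfolding bulk_norm_def l2_norm_def
      using volume normal_deriv_diff[OF K3 v w]
      by (intro arg_cong[where f = sqrt] set_lebesgue_integral_cong) auto
    ultimately show ?thesis by (simp add: l2_inner_def)
  qed
  have bulk_square: "(LINT x:\<Union>K|lborel. normal_deriv K \<phi>h v x * normal_deriv K \<phi>h v x)
      = (bulk_norm K (normal_deriv K \<phi>h v))\<^sup>2" for v
    by (simp add: bulk_norm_def l2_norm_square l2_inner_def)
  show ?thesis (is "(\<forall>n. ?balance n) \<and> _")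
  proof
    show balance: "\<forall>n. ?balance n"
    proof
      fix n
      define d where "d = (\<lambda>x. c (Suc n) x - c n x)"
      have d: "d \<in> p1_space K" unfolding d_def by (intro p1_space_diff c)
      have mass: "\<rho> * surface_inner K \<phi>h d (\<mu> (Suc n)) =
            - \<Delta>t * surface_inner K \<phi>h
                (\<lambda>x. mobility (c n x) *\<^sub>R surface_grad K \<phi>h (\<mu> (Suc n)) x) (surface_grad K \<phi>h (\<mu> (Suc n)))
            - h * \<Delta>t * (bulk_norm K (normal_deriv K \<phi>h (\<mu> (Suc n))))\<^sup>2"
        using scheme \<mu>[of n] unfolding sav_bdf1_def d_def bulk_square[symmetric] by blast
      have "surface_inner K \<phi>h (\<mu> (Suc n)) d =
            r (Suc n) / sqrt (E1 \<Gamma> (c n)) * surface_inner K \<phi>h (\<lambda>x. deriv f0 (c n x)) d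
            + \<epsilon>\<^sup>2 * surface_inner K \<phi>h (surface_grad K \<phi>h (c (Suc n))) (surface_grad K \<phi>h d)
            + inverse h * \<epsilon>\<^sup>2 * (LINT x:\<Union>K|lborel.
                normal_deriv K \<phi>h (c (Suc n)) x * normal_deriv K \<phi>h d x)"
        using scheme d unfolding sav_bdf1_def by blast
      then have potential: "surface_inner K \<phi>h d (\<mu> (Suc n)) =
            r (Suc n) / sqrt (E1 \<Gamma> (c n)) * surface_inner K \<phi>h (\<lambda>x. deriv f0 (c n x)) d
            + \<epsilon>\<^sup>2 * surface_inner K \<phi>h (surface_grad K \<phi>h (c (Suc n))) (surface_grad K \<phi>h d)
            + inverse h * \<epsilon>\<^sup>2 * (LINT x:\<Union>K|lborel.
                normal_deriv K \<phi>h (c (Suc n)) x * normal_deriv K \<phi>h d x)"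
        by (simp add: surface_inner_def l2_inner_commute)
      have auxiliary: "r (Suc n) - r n =
          1 / (2 * sqrt (E1 \<Gamma> (c n))) * surface_inner K \<phi>h (\<lambda>x. deriv f0 (c n x)) d"
        using scheme unfolding sav_bdf1_def d_def by blast
      have "0 < sqrt (E1 \<Gamma> (c n))" using E1_pos by simp
      from sav_step_energy_balance[OF constants(1) this mass potential auxiliary
          surface_increment[OF c c, of "Suc n" n, folded d_def]
          bulk_increment[OF c c, of "Suc n" n, folded d_def]]
      show "?balance n" unfolding sav_energy_def d_def .
    qed
    show "\<forall>n. (\<forall>x\<in>discrete_surface K \<phi>h. 0 \<le> mobility (c n x)) \<longrightarrow>
        sav_energy K \<phi>h h \<epsilon> (c (Suc n)) (r (Suc n)) \<le> sav_energy K \<phi>h h \<epsilon> (c n) (r n)"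
    proof (intro allI impI)
      fix n assume M: "\<forall>x\<in>discrete_surface K \<phi>h. 0 \<le> mobility (c n x)"
      have "0 \<le> surface_inner K \<phi>h
          (\<lambda>x. mobility (c n x) *\<^sub>R surface_grad K \<phi>h (\<mu> (Suc n)) x) (surface_grad K \<phi>h (\<mu> (Suc n)))"
        unfolding surface_inner_def using M by (intro l2_inner_nonneg) simp
      then have "0 \<le> \<Delta>t / \<rho> * surface_inner K \<phi>h
          (\<lambda>x. mobility (c n x) *\<^sub>R surface_grad K \<phi>h (\<mu> (Suc n)) x) (surface_grad K \<phi>h (\<mu> (Suc n)))"
        using constants by (intro mult_nonneg_nonneg) auto
      moreover have "0 \<le> h * \<Delta>t / \<rho> * (bulk_norm K (normal_deriv K \<phi>h (\<mu> (Suc n))))\<^sup>2"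
        using constants h(2) by (intro mult_nonneg_nonneg) auto
      moreover have "0 \<le> \<epsilon>\<^sup>2 / 2 * (surface_norm K \<phi>h
            (\<lambda>x. surface_grad K \<phi>h (c (Suc n)) x - surface_grad K \<phi>h (c n) x))\<^sup>2"
        by simp
      moreover have "0 \<le> \<bar>r (Suc n) - r n\<bar>\<^sup>2" by simp
      moreover have "0 \<le> inverse h * \<epsilon>\<^sup>2 / 2 *
            (bulk_norm K (normal_deriv K \<phi>h (\<lambda>x. c (Suc n) x - c n x)))\<^sup>2"
        using h(2) by (intro mult_nonneg_nonneg) auto
      moreover note spec[OF balance, of n]
      ultimately show "sav_energy K \<phi>h h \<epsilon> (c (Suc n)) (r (Suc n)) \<le> sav_energy K \<phi>h h \<epsilon> (c n) (r n)"
        by linarith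
    qed
  qed
qed

end
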